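(* Let $F$ be an ordered field with an integer part $I$, and let $\rho,\sigma\in F$ be rational with $\rho,\sigma>1$. (1) If there exist $a,b\in I^{>0}$ such that $a\rho^{-1}+b(1-\sigma^{-1})=1$, then $N_{\rho}\subseteq N_{\sigma}$. (2) If $I$ is Bézout and $N_{\rho}\subseteq N_{\sigma}$, then there exist $a,b\in I^{>0}$ such that $a\rho^{-1}+b(1-\sigma^{-1})=1$.
   Context: A subring $I$ of an ordered field $F$ is an integer part of $F$ if $I$ is discretely ordered (no $x\in I$ satisfies $0<x<1$) and for every $x\in F$ there is a (necessarily unique) $a\in I$ with $a\leqslant x<a+1$; this $a$ is denoted $\lfloor x\rfloor$. $I^{\geqslant 0}$, $I^{>0}$ are the sets of nonnegative, respectively positive, elements of $I$. An element of $F$ is rational if it lies in the fraction field $\mathrm{Frac}(I)\subseteq F$. For $\alpha\in F$ positive, $N_\alpha=\{\lfloor n\alpha\rfloor : n\in I^{\geqslant 0}\}$. $I$ is Bézout if for all nonzero $m,n\in I$ there exist $r,s\in I$ such that $rm+sn\geqslant 1$ and $rm+sn$ divides both $m$ and $n$ in $I$. *)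

theory Defs
  imports Main
begin

definition is_subring :: "'a::ring_1 set \<Rightarrow> bool" where
  "is_subring I \<longleftrightarrow>
     0 \<in> I \<and> 1 \<in> I \<and>
     (\<forall>x\<in>I. - x \<in> I) \<and> (\<forall>x\<in>I. \<forall>y\<in>I. x + y \<in> I) \<and> (\<forall>x\<in>I. \<forall>y\<in>I. x * y \<in> I)"

text \<open>
  The ordered field is the whole type (possibly non-archimedean), so the library's
  \<open>floor\<close> and \<open>\<int>\<close> do not apply: integers and floors are relative to \<open>I\<close>.
\<close>

definition integer_part :: "'a::linordered_field set \<Rightarrow> bool" where
  "integer_part I \<longleftrightarrow>
     is_subring I \<and>
     \<not> (\<exists>x\<in>I. 0 < x \<and> x < 1) \<and>
     (\<forall>x. \<exists>a\<in>I. a \<le> x \<and> x < a + 1)"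

definition floor_in :: "'a::linordered_field set \<Rightarrow> 'a \<Rightarrow> 'a" where
  "floor_in I x = (THE a. a \<in> I \<and> a \<le> x \<and> x < a + 1)"

lemma floor_in_unique:
  assumes I: "integer_part I" and a: "a \<in> I" "a \<le> x" "x < a + 1"
  shows "floor_in I x = a"
proof -
  have *: "\<not> c < d" if "c \<in> I" "d \<in> I" "d \<le> x" "x < c + 1" for c d
  proof
    assume "c < d"
    have "d + - c \<in> I"
      using I that unfolding integer_part_def is_subring_def by blast
    moreover have "0 < d + - c" "d + - c < 1"
      using \<open>c < d\<close> that by (auto simp: algebra_simps)
    ultimately show False
      using I unfolding integer_part_def by blast
  qed
  show ?thesis
    unfolding floor_in_def
    by (rule the_equality) (use a * in \<open>blast, metis antisym_conv3\<close>)
qed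

lemma floor_in:
  assumes "integer_part I"
  shows "floor_in I x \<in> I" "floor_in I x \<le> x" "x < floor_in I x + 1"
proof -
  obtain a where "a \<in> I" "a \<le> x" "x < a + 1"
    using assms unfolding integer_part_def by blast
  with floor_in_unique[OF assms this]
  show "floor_in I x \<in> I" "floor_in I x \<le> x" "x < floor_in I x + 1" by auto
qed

definition Frac :: "'a::field set \<Rightarrow> 'a set" where
  "Frac I = {p / q | p q. p \<in> I \<and> q \<in> I \<and> q \<noteq> 0}"

definition beatty_set :: "'a::linordered_field set \<Rightarrow> 'a \<Rightarrow> 'a set" where
  "beatty_set I \<alpha> = {floor_in I (n * \<alpha>) | n. n \<in> I \<and> 0 \<le> n}"

text \<open>Divisibility must be relative to \<open>I\<close>; the class operation \<open>dvd\<close> is trivial in a field.\<close>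

definition dvd_in :: "'a::comm_ring_1 set \<Rightarrow> 'a \<Rightarrow> 'a \<Rightarrow> bool" where
  "dvd_in I d m \<longleftrightarrow> (\<exists>k\<in>I. m = d * k)"

definition bezout :: "'a::linordered_field set \<Rightarrow> bool" where
  "bezout I \<longleftrightarrow>
     (\<forall>m\<in>I. \<forall>n\<in>I. m \<noteq> 0 \<longrightarrow> n \<noteq> 0 \<longrightarrow>
        (\<exists>r\<in>I. \<exists>s\<in>I. 1 \<le> r * m + s * n \<and>
           dvd_in I (r * m + s * n) m \<and> dvd_in I (r * m + s * n) n))"

end

theory Submission
  imports Defs
begin

text \<open>
  Put \<open>\<theta> = 1/\<rho>\<close> and \<open>\<tau> = 1 - 1/\<sigma>\<close>. For \<open>k \<ge> 0\<close> in \<open>I\<close>, membership in the two Beatty sets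
  is a condition on half-open intervals: \<open>k\<close> lies in \<open>N\<^sub>\<rho>\<close> iff some \<open>n \<in> I\<close> has
  \<open>k\<theta> \<le> n < (k + 1)\<theta>\<close>, and \<open>k\<close> lies outside \<open>N\<^sub>\<sigma>\<close> iff some \<open>m \<in> I\<close> has
  \<open>k\<tau> < m \<le> (k + 1)\<tau>\<close> (Beatty's theorem in a form that holds for every slope: the complement
  is again given by half-open intervals, but closed at the other end).

  If \<open>a\<theta> + b\<tau> = 1\<close> with \<open>a, b > 0\<close>, a witness \<open>k\<close> against \<open>N\<^sub>\<rho> \<subseteq> N\<^sub>\<sigma>\<close> would give
  \<open>k < an + bm < k + 1\<close>, which is impossible in a discretely ordered ring.

  Conversely, write \<open>\<theta> = u/d\<close> and \<open>\<tau> = v/d\<close> over a common denominator. The inclusion says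
  exactly that the lattice \<open>L = I(u, v) + dI\<^sup>2\<close> has no point in the box \<open>[0, u) \<times> (0, v]\<close>
  (\<open>lattice_avoids_box\<close> is the direction that matters). Emptiness of the box first forces
  \<open>g = gcd(u, v)\<close> to divide \<open>d\<close>: otherwise \<open>h = gcd(g, d) < g\<close> and \<open>L\<close> contains
  \<open>(u, v)\<close> scaled by \<open>h/g < 1\<close>. Dividing by \<open>g\<close>, one solves \<open>aU + bV = D\<close> with
  \<open>0 < a \<le> V\<close>; if \<open>b\<close> were not positive, then \<open>(-bg, ag)\<close> would be a lattice point in the box.
\<close>

section \<open>Arithmetic in an integer part\<close>

lemma integer_part_closed:
  assumes "integer_part I"
  shows "0 \<in> I" "1 \<in> I"
    and "x \<in> I \<Longrightarrow> - x \<in> I"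
    and "x \<in> I \<Longrightarrow> y \<in> I \<Longrightarrow> x + y \<in> I"
    and "x \<in> I \<Longrightarrow> y \<in> I \<Longrightarrow> x - y \<in> I"
    and "x \<in> I \<Longrightarrow> y \<in> I \<Longrightarrow> x * y \<in> I"
    and "x \<in> I \<Longrightarrow> \<bar>x\<bar> \<in> I"
proof -
  have sub: "is_subring I" using assms unfolding integer_part_def by blast
  show "0 \<in> I" "1 \<in> I" "x \<in> I \<Longrightarrow> - x \<in> I"
    "x \<in> I \<Longrightarrow> y \<in> I \<Longrightarrow> x + y \<in> I" "x \<in> I \<Longrightarrow> y \<in> I \<Longrightarrow> x * y \<in> I"
    using sub unfolding is_subring_def by blast+
  show "x \<in> I \<Longrightarrow> y \<in> I \<Longrightarrow> x - y \<in> I"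
    using sub unfolding is_subring_def by (metis add_uminus_conv_diff)
  show "x \<in> I \<Longrightarrow> \<bar>x\<bar> \<in> I"
    using sub unfolding is_subring_def by (simp add: abs_if)
qed

lemma no_element_between:
  assumes I: "integer_part I" and "k \<in> I" "z \<in> I" "k < z"
  shows "k + 1 \<le> z"
proof (rule ccontr)
  assume "\<not> k + 1 \<le> z"
  then have "0 < z - k" "z - k < 1" using \<open>k < z\<close> by (auto simp: algebra_simps)
  moreover have "z - k \<in> I" using assms by (intro integer_part_closed[OF I])
  ultimately show False using I unfolding integer_part_def by blast
qed

lemma one_le_of_pos:
  assumes "integer_part I" "z \<in> I" "0 < z"
  shows "1 \<le> z"
  using no_element_between[OF assms(1) integer_part_closed(1)[OF assms(1)] assms(2,3)] by simp

text \<open>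
  Euclidean division with remainders normalised to \<open>(0, V]\<close> rather than \<open>[0, V)\<close>, to match the box
  \<open>[0, u) \<times> (0, v]\<close> of lattice points below.
\<close>

lemma pos_remainder:
  assumes I: "integer_part I" and V: "V \<in> I" "0 < V" and x: "x \<in> I"
  obtains t where "t \<in> I" "0 < x - t * V" "x - t * V \<le> V"
proof -
  \<comment> \<open>\<open>- c\<close> is the ceiling of \<open>x / V\<close>, so the quotient wanted is \<open>- c - 1\<close>.\<close>
  define c where "c = floor_in I (- x / V)"
  have c: "c \<in> I" "c \<le> - x / V" "- x / V < c + 1"
    unfolding c_def using floor_in[OF I] by auto
  show ?thesis
  proof (rule that[of "- c - 1"])
    show "- c - 1 \<in> I" using c(1) by (intro integer_part_closed[OF I])
    show "0 < x - (- c - 1) * V" "x - (- c - 1) * V \<le> V"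
      using c(2,3) V(2) by (auto simp: field_simps)
  qed
qed

lemma bezout_gcd:
  assumes "integer_part I" "bezout I" and "m \<in> I" "n \<in> I" "0 < m" "0 < n"
  obtains g r s M N where "r \<in> I" "s \<in> I" "g = r * m + s * n" "g \<in> I" "0 < g"
    "M \<in> I" "N \<in> I" "m = g * M" "n = g * N" "0 < M" "0 < N"
proof -
  obtain r s where rs: "r \<in> I" "s \<in> I" "1 \<le> r * m + s * n"
    and dvd: "dvd_in I (r * m + s * n) m" "dvd_in I (r * m + s * n) n"
    using assms unfolding bezout_def by (metis less_irrefl)
  then obtain M N where MN: "M \<in> I" "N \<in> I" "m = (r * m + s * n) * M" "n = (r * m + s * n) * N"
    unfolding dvd_in_def by blast
  have g: "0 < r * m + s * n" using rs(3) by (rule less_le_trans[OF zero_less_one])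
  moreover have "0 < M" "0 < N" using MN(3,4) assms(5,6) g by (metis zero_less_mult_pos)+
  moreover have "r * m + s * n \<in> I" using assms rs by (intro integer_part_closed[OF assms(1)])
  ultimately show ?thesis using that rs MN by blast
qed

lemma Frac_pos:
  assumes I: "integer_part I" and "x \<in> Frac I" "0 < x"
  obtains p q where "p \<in> I" "q \<in> I" "0 < p" "0 < q" "x = p / q"
proof -
  obtain p q where pq: "p \<in> I" "q \<in> I" "q \<noteq> 0" "x = p / q"
    using assms(2) unfolding Frac_def by blast
  have "x = \<bar>p\<bar> / \<bar>q\<bar>" using pq(4) \<open>0 < x\<close> by (metis abs_divide abs_of_pos)
  moreover have "p \<noteq> 0" using pq(4) \<open>0 < x\<close> by auto
  ultimately show ?thesis
    using that[of "\<bar>p\<bar>" "\<bar>q\<bar>"] pq integer_part_closed(7)[OF I] by simp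
qed

section \<open>Membership in Beatty sets and in their complements\<close>

lemma beatty_set_nonneg:
  assumes I: "integer_part I" and "0 < \<alpha>" "k \<in> beatty_set I \<alpha>"
  shows "k \<in> I" "0 \<le> k"
proof -
  obtain n where n: "0 \<le> n" "k = floor_in I (n * \<alpha>)"
    using assms(3) unfolding beatty_set_def by blast
  note k = floor_in[OF I, of "n * \<alpha>", folded n(2)]
  show "k \<in> I" by (rule k(1))
  have "0 < k + 1" using k(3) n(1) \<open>0 < \<alpha>\<close> by (meson le_less_trans mult_nonneg_nonneg less_imp_le)
  moreover have "k + 1 \<in> I" using k(1) by (intro integer_part_closed[OF I])
  ultimately show "0 \<le> k" using one_le_of_pos[OF I] by fastforce
qed

lemma mem_beatty_set_iff:
  assumes I: "integer_part I" and \<alpha>: "0 < \<alpha>" and k: "k \<in> I" "0 \<le> k"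
  shows "k \<in> beatty_set I \<alpha> \<longleftrightarrow> (\<exists>n\<in>I. k * inverse \<alpha> \<le> n \<and> n < (k + 1) * inverse \<alpha>)"
proof -
  have scale: "(k * inverse \<alpha> \<le> n \<and> n < (k + 1) * inverse \<alpha>) \<longleftrightarrow> k \<le> n * \<alpha> \<and> n * \<alpha> < k + 1" for n
    using \<alpha> by (simp add: field_simps)
  show ?thesis
  proof
    assume "k \<in> beatty_set I \<alpha>"
    then obtain n where "n \<in> I" "k = floor_in I (n * \<alpha>)"
      unfolding beatty_set_def by blast
    then show "\<exists>n\<in>I. k * inverse \<alpha> \<le> n \<and> n < (k + 1) * inverse \<alpha>"
      unfolding scale using floor_in[OF I] by blast
  next
    assume "\<exists>n\<in>I. k * inverse \<alpha> \<le> n \<and> n < (k + 1) * inverse \<alpha>"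
    then obtain n where n: "n \<in> I" "k \<le> n * \<alpha>" "n * \<alpha> < k + 1"
      unfolding scale by blast
    then have "0 \<le> n * \<alpha>" using k(2) by linarith
    then have "0 \<le> n" using \<alpha> by (simp add: zero_le_mult_iff)
    then show "k \<in> beatty_set I \<alpha>"
      unfolding beatty_set_def using floor_in_unique[OF I k(1) n(2,3)] n(1) by blast
  qed
qed

text \<open>
  Subtracting from \<open>k\<close> turns \<open>k/\<sigma> \<le> n < (k + 1)/\<sigma>\<close> into \<open>m \<le> k\<tau>\<close> and \<open>(k + 1)\<tau> < m + 1\<close> for
  \<open>m = k - n\<close> and \<open>\<tau> = 1 - 1/\<sigma>\<close>. So \<open>k\<close> lies in the Beatty set iff passing from \<open>k\<tau>\<close> to
  \<open>(k + 1)\<tau>\<close> reaches no new element of \<open>I\<close>.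
\<close>

lemma not_mem_beatty_set_iff:
  assumes I: "integer_part I" and \<sigma>: "1 < \<sigma>" and k: "k \<in> I" "0 \<le> k"
  defines "\<tau> \<equiv> 1 - inverse \<sigma>"
  shows "k \<notin> beatty_set I \<sigma> \<longleftrightarrow> (\<exists>m\<in>I. k * \<tau> < m \<and> m \<le> (k + 1) * \<tau>)"
proof -
  note mem = mem_beatty_set_iff[OF I less_trans[OF zero_less_one \<sigma>] k]
  have inv: "inverse \<sigma> = 1 - \<tau>" unfolding \<tau>_def by simp
  show ?thesis
  proof
    assume notin: "k \<notin> beatty_set I \<sigma>"
    define m where "m = floor_in I ((k + 1) * \<tau>)"
    have m: "m \<in> I" "m \<le> (k + 1) * \<tau>" "(k + 1) * \<tau> < m + 1"
      unfolding m_def using floor_in[OF I] by auto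
    have "k * \<tau> < m"
    proof (rule ccontr)
      assume "\<not> k * \<tau> < m"
      then have "k * inverse \<sigma> \<le> k - m" "k - m < (k + 1) * inverse \<sigma>"
        using m(3) unfolding inv by (auto simp: algebra_simps)
      moreover have "k - m \<in> I" using k m by (intro integer_part_closed[OF I])
      ultimately show False using notin unfolding mem by blast
    qed
    then show "\<exists>m\<in>I. k * \<tau> < m \<and> m \<le> (k + 1) * \<tau>" using m by blast
  next
    assume "\<exists>m\<in>I. k * \<tau> < m \<and> m \<le> (k + 1) * \<tau>"
    then obtain m where m: "m \<in> I" "k * \<tau> < m" "m \<le> (k + 1) * \<tau>" by blast
    show "k \<notin> beatty_set I \<sigma>"
    proof
      assume "k \<in> beatty_set I \<sigma>"
      then obtain n where n: "n \<in> I" "k * (1 - \<tau>) \<le> n" "n < (k + 1) * (1 - \<tau>)"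
        unfolding mem inv by blast
      have "k < n + m" using m(2) n(2) by (simp add: algebra_simps)
      moreover have "n + m < k + 1" using m(3) n(3) by (simp add: algebra_simps)
      moreover have "n + m \<in> I" using m n by (intro integer_part_closed[OF I])
      ultimately show False using no_element_between[OF I k(1), of "n + m"] by simp
    qed
  qed
qed

section \<open>A positive linear relation implies inclusion\<close>

lemma beatty_set_subset_if_relation:
  assumes I: "integer_part I" and \<rho>: "1 < \<rho>" and \<sigma>: "1 < \<sigma>"
    and a: "a \<in> I" "0 < a" and b: "b \<in> I" "0 < b"
    and ab: "a * inverse \<rho> + b * (1 - inverse \<sigma>) = 1"
  shows "beatty_set I \<rho> \<subseteq> beatty_set I \<sigma>"
proof
  fix k assume k: "k \<in> beatty_set I \<rho>"
  have \<rho>0: "0 < \<rho>" using \<rho> by (rule less_trans[OF zero_less_one])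
  note kI = beatty_set_nonneg[OF I \<rho>0 k]
  show "k \<in> beatty_set I \<sigma>"
  proof (rule ccontr)
    assume "k \<notin> beatty_set I \<sigma>"
    then obtain m where m: "m \<in> I" "k * (1 - inverse \<sigma>) < m" "m \<le> (k + 1) * (1 - inverse \<sigma>)"
      unfolding not_mem_beatty_set_iff[OF I \<sigma> kI] by blast
    obtain n where n: "n \<in> I" "k * inverse \<rho> \<le> n" "n < (k + 1) * inverse \<rho>"
      using k unfolding mem_beatty_set_iff[OF I \<rho>0 kI] by blast
    have split: "x = a * (x * inverse \<rho>) + b * (x * (1 - inverse \<sigma>))" for x
      using arg_cong[OF ab, of "\<lambda>y. x * y"] by (simp add: algebra_simps)
    have "k < a * n + b * m"
      using a b m(2) n(2) by (subst split[of k], intro add_le_less_mono) auto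
    moreover have "a * n + b * m < k + 1"
      using a b m(3) n(3) by (subst split[of "k + 1"], intro add_less_le_mono) auto
    moreover have "a * n + b * m \<in> I" using a b m n by (intro integer_part_closed[OF I])
    ultimately show False using no_element_between[OF I kI(1), of "a * n + b * m"] by simp
  qed
qed

section \<open>Inclusion forces a positive linear relation\<close>

text \<open>
  A lattice point \<open>(x, y) \<equiv> k(u, v)\<close> modulo \<open>d\<close> in the box would make \<open>K = -k\<close> a witness against the
  inclusion, since \<open>Ku + x\<close> and \<open>Kv + y\<close> are multiples of \<open>d\<close>. Adding a multiple of \<open>d\<close> to \<open>K\<close> makes
  it nonnegative without changing the lattice point.
\<close>

lemma lattice_avoids_box:
  assumes I: "integer_part I" and \<rho>: "1 < \<rho>" and \<sigma>: "1 < \<sigma>"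
    and sub: "beatty_set I \<rho> \<subseteq> beatty_set I \<sigma>"
    and uvd: "u \<in> I" "v \<in> I" "d \<in> I" "0 < d"
    and inv: "inverse \<rho> = u / d" "1 - inverse \<sigma> = v / d"
    and kmn: "k \<in> I" "n \<in> I" "m \<in> I"
    and x: "0 \<le> k * u + n * d" "k * u + n * d < u"
    and y: "0 < k * v + m * d" "k * v + m * d \<le> v"
  shows False
proof -
  define K where "K = \<bar>k\<bar> * d - k"
  define N where "N = n + \<bar>k\<bar> * u"
  define M where "M = m + \<bar>k\<bar> * v"
  have mem: "K \<in> I" "N \<in> I" "M \<in> I"
    unfolding K_def N_def M_def using kmn uvd by (simp_all add: integer_part_closed[OF I])
  have "\<bar>k\<bar> * 1 \<le> \<bar>k\<bar> * d"
    using one_le_of_pos[OF I uvd(3,4)] by (intro mult_left_mono) auto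
  then have K0: "0 \<le> K" unfolding K_def using abs_ge_self[of k] by linarith
  have N: "N * d = K * u + (k * u + n * d)" and M: "M * d = K * v + (k * v + m * d)"
    unfolding N_def M_def K_def by (simp_all add: algebra_simps)
  have "K * u \<le> N * d" "N * d < (K + 1) * u"
    using x unfolding N by (auto simp: algebra_simps)
  then have "K * inverse \<rho> \<le> N \<and> N < (K + 1) * inverse \<rho>"
    unfolding inv using \<open>0 < d\<close> by (simp add: field_simps)
  then have "K \<in> beatty_set I \<rho>"
    using mem_beatty_set_iff[OF I less_trans[OF zero_less_one \<rho>] mem(1) K0] mem(2) by blast
  moreover have "K * v < M * d" "M * d \<le> (K + 1) * v"
    using y unfolding M by (auto simp: algebra_simps)
  then have "K * (1 - inverse \<sigma>) < M \<and> M \<le> (K + 1) * (1 - inverse \<sigma>)"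
    unfolding inv using \<open>0 < d\<close> by (simp add: field_simps)
  then have "K \<notin> beatty_set I \<sigma>"
    using not_mem_beatty_set_iff[OF I \<sigma> mem(1) K0] mem(3) by blast
  ultimately show False using sub by blast
qed

text \<open>
  The geometric core: an empty box forces a linear form \<open>(ax + by)/d\<close> with \<open>a, b > 0\<close> that maps \<open>(u, v)\<close>
  to \<open>1\<close>. Such forms come in a family \<open>(a - tV, b + tU)\<close>; normalising \<open>a\<close> to \<open>(0, V]\<close> singles out the
  only candidate that matters, and if its \<open>b\<close> fails to be positive, then its kernel direction \<open>(-b, a)\<close>,
  scaled by \<open>g\<close>, is a lattice point inside the box.
\<close>

lemma relation_if_box_empty:
  assumes I: "integer_part I" and B: "bezout I"
    and uvd: "u \<in> I" "v \<in> I" "d \<in> I" "0 < u" "0 < v" "0 < d"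
    and empty: "\<And>k n m. k \<in> I \<Longrightarrow> n \<in> I \<Longrightarrow> m \<in> I \<Longrightarrow>
       0 \<le> k * u + n * d \<Longrightarrow> k * u + n * d < u \<Longrightarrow>
       0 < k * v + m * d \<Longrightarrow> k * v + m * d \<le> v \<Longrightarrow> False"
  obtains a b where "a \<in> I" "b \<in> I" "0 < a" "0 < b" "a * u + b * v = d"
proof -
  note closed = integer_part_closed[OF I]
  obtain g r s U V where g: "r \<in> I" "s \<in> I" "g = r * u + s * v" "g \<in> I" "0 < g"
    and UV: "U \<in> I" "V \<in> I" "u = g * U" "v = g * V" "0 < U" "0 < V"
    by (rule bezout_gcd[OF I B uvd(1,2,4,5)])
  obtain h \<alpha> \<beta> G D where h: "\<alpha> \<in> I" "\<beta> \<in> I" "h = \<alpha> * g + \<beta> * d" "h \<in> I" "0 < h"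
    and GD: "G \<in> I" "D \<in> I" "g = h * G" "d = h * D" "0 < G" "0 < D"
    by (rule bezout_gcd[OF I B g(4) uvd(3) g(5) uvd(6)])
  \<comment> \<open>The lattice contains \<open>(hU, hV)\<close>, which lies in the box as soon as \<open>h < g\<close>.\<close>
  have "\<not> h < g"
  proof
    assume lt: "h < g"
    have eq: "\<alpha> * u + (\<beta> * U) * d = h * U" "\<alpha> * v + (\<beta> * V) * d = h * V"
      unfolding h(3) UV(3,4) by (simp_all add: algebra_simps)
    show False
    proof (rule empty[of \<alpha> "\<beta> * U" "\<beta> * V", unfolded eq])
      show "\<alpha> \<in> I" "\<beta> * U \<in> I" "\<beta> * V \<in> I" using h(1,2) UV(1,2) by (simp_all add: closed)
      show "0 \<le> h * U" "0 < h * V" using h(5) UV(5,6) by auto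
      show "h * U < u" "h * V \<le> v"
        using lt UV(5,6) unfolding UV(3,4) by (auto intro: mult_strict_right_mono mult_right_mono)
    qed
  qed
  moreover have "h * 1 \<le> h * G"
    using one_le_of_pos[OF I GD(1,5)] h(5) by (intro mult_left_mono) auto
  ultimately have hg: "h = g" using GD(3) by simp
  have d: "d = g * D" using GD(4) hg by simp
  have "g * (r * U + s * V) = g * 1" using g(3) UV(3,4) by (simp add: algebra_simps)
  then have one: "r * U + s * V = 1" using g(5) by (metis mult_cancel_left less_irrefl)
  obtain t where t: "t \<in> I" "0 < r * D - t * V" "r * D - t * V \<le> V"
    using pos_remainder[OF I UV(2,6), of "r * D"] g(1) GD(2) by (blast intro: closed(6))
  define a where "a = r * D - t * V"
  define b where "b = s * D + t * U"
  have aI: "a \<in> I" and bI: "b \<in> I"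
    unfolding a_def b_def using t(1) g(1,2) GD(2) UV(1,2) by (simp_all add: closed)
  have a0: "0 < a" and aV: "a \<le> V" using t unfolding a_def by auto
  have "a * U + b * V = D * (r * U + s * V)"
    unfolding a_def b_def by (simp add: algebra_simps)
  then have ab: "a * U + b * V = D" using one by simp
  have "0 < b"
  proof (rule ccontr)
    assume "\<not> 0 < b"
    then have b0: "b \<le> 0" by simp
    \<comment> \<open>\<open>(-b, a)\<close> is congruent to \<open>k(U, V)\<close> modulo \<open>D\<close>: multiply it by \<open>rU + sV = 1\<close> and use
      \<open>aU \<equiv> -bV\<close>.\<close>
    define k where "k = s * a - r * b"
    have "k * U + (- s) * D = - b * (r * U + s * V)"
      unfolding k_def ab[symmetric] by (simp add: algebra_simps)
    then have kU: "k * U + (- s) * D = - b" using one by simp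
    have "k * V + r * D = a * (r * U + s * V)"
      unfolding k_def ab[symmetric] by (simp add: algebra_simps)
    then have kV: "k * V + r * D = a" using one by simp
    have eq: "k * u + (- s) * d = g * (- b)" "k * v + r * d = g * a"
      unfolding kU[symmetric] kV[symmetric] UV(3,4) d by (simp_all add: algebra_simps)
    have "V * (- b) = a * U - D" using ab by (simp add: algebra_simps)
    also have "\<dots> < a * U" using GD(6) by simp
    also have "\<dots> \<le> V * U" using aV UV(5) by (simp add: mult_right_mono)
    finally have bU: "- b < U" using UV(6) by (metis mult_less_cancel_left_pos)
    show False
    proof (rule empty[of k "- s" r, unfolded eq])
      show "k \<in> I" unfolding k_def using aI bI g(1,2) by (intro closed)
      show "- s \<in> I" "r \<in> I" using g(1,2) by (simp_all add: closed)
      show "0 \<le> g * (- b)" using g(5) b0 by (intro mult_nonneg_nonneg) auto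
      show "g * (- b) < u" unfolding UV(3) using bU g(5) by (rule mult_strict_left_mono)
      show "0 < g * a" using g(5) a0 by simp
      show "g * a \<le> v" unfolding UV(4) using aV g(5) by simp
    qed
  qed
  moreover have "a * u + b * v = d"
    unfolding d UV(3,4) ab[symmetric] by (simp add: algebra_simps)
  ultimately show ?thesis using that aI bI a0 by blast
qed

lemma relation_if_beatty_set_subset:
  assumes I: "integer_part I" and B: "bezout I"
    and frac: "\<rho> \<in> Frac I" "\<sigma> \<in> Frac I" and \<rho>: "1 < \<rho>" and \<sigma>: "1 < \<sigma>"
    and sub: "beatty_set I \<rho> \<subseteq> beatty_set I \<sigma>"
  obtains a b where "a \<in> I" "b \<in> I" "0 < a" "0 < b" "a * inverse \<rho> + b * (1 - inverse \<sigma>) = 1"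
proof -
  note closed = integer_part_closed[OF I]
  obtain p q where pq: "p \<in> I" "q \<in> I" "0 < p" "0 < q" "\<rho> = p / q"
    using Frac_pos[OF I frac(1) less_trans[OF zero_less_one \<rho>]] by blast
  obtain p' q' where pq': "p' \<in> I" "q' \<in> I" "0 < p'" "0 < q'" "\<sigma> = p' / q'"
    using Frac_pos[OF I frac(2) less_trans[OF zero_less_one \<sigma>]] by blast
  define u where "u = q * p'"
  define v where "v = p * (p' - q')"
  define d where "d = p * p'"
  have uvd: "u \<in> I" "v \<in> I" "d \<in> I"
    unfolding u_def v_def d_def using pq(1,2) pq'(1,2) by (simp_all add: closed)
  have "q' < p'" using \<sigma> pq' by simp
  then have pos: "0 < u" "0 < v" "0 < d" unfolding u_def v_def d_def using pq pq' by auto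
  have inv: "inverse \<rho> = u / d" "1 - inverse \<sigma> = v / d"
    unfolding u_def v_def d_def pq(5) pq'(5) using pq(3,4) pq'(3,4) by (auto simp: field_simps)
  obtain a b where ab: "a \<in> I" "b \<in> I" "0 < a" "0 < b" "a * u + b * v = d"
    using relation_if_box_empty[OF I B uvd pos]
      lattice_avoids_box[OF I \<rho> \<sigma> sub uvd pos(3) inv] by blast
  have "a * inverse \<rho> + b * (1 - inverse \<sigma>) = (a * u + b * v) / d"
    unfolding inv by (simp add: add_divide_distrib)
  then have "a * inverse \<rho> + b * (1 - inverse \<sigma>) = 1" using ab(5) pos(3) by simp
  then show ?thesis using that ab(1-4) by blast
qed

theorem theorem2p11:
  fixes I :: "'a::linordered_field set" and \<rho> \<sigma> :: 'a
  assumes "integer_part I"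
    and "\<rho> \<in> Frac I" and "\<sigma> \<in> Frac I"
    and "1 < \<rho>" and "1 < \<sigma>"
  shows "((\<exists>a\<in>I. \<exists>b\<in>I. 0 < a \<and> 0 < b \<and> a * inverse \<rho> + b * (1 - inverse \<sigma>) = 1)
            \<longrightarrow> beatty_set I \<rho> \<subseteq> beatty_set I \<sigma>) \<and>
         (bezout I \<and> beatty_set I \<rho> \<subseteq> beatty_set I \<sigma>
            \<longrightarrow> (\<exists>a\<in>I. \<exists>b\<in>I. 0 < a \<and> 0 < b \<and> a * inverse \<rho> + b * (1 - inverse \<sigma>) = 1))"
proof (intro conjI impI; (elim conjE bexE)?)
  fix a b
  assume "a \<in> I" "b \<in> I" "0 < a" "0 < b" "a * inverse \<rho> + b * (1 - inverse \<sigma>) = 1"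
  then show "beatty_set I \<rho> \<subseteq> beatty_set I \<sigma>"
    using beatty_set_subset_if_relation assms(1,4,5) by blast
next
  assume "bezout I" "beatty_set I \<rho> \<subseteq> beatty_set I \<sigma>"
  then show "\<exists>a\<in>I. \<exists>b\<in>I. 0 < a \<and> 0 < b \<and> a * inverse \<rho> + b * (1 - inverse \<sigma>) = 1"
    using relation_if_beatty_set_subset[OF assms(1) _ assms(2-5)] by metis
qed

end
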